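(* Let $b,n,s$ be nonnegative integers with $n\ge bs$ and let $x\in[0,1)$. Then $$\mathfrak{B}(-n,bs;x)=\mathfrak{S}_{n}(bs,x),$$ where $\mathfrak{B}(-n,bs;x)$ denotes the limit $\lim_{z\to -n}\mathfrak{B}(z,bs;x)$.
   Context: For nonnegative integers $b,s$ and $x\in[0,1]$, the polynomials $\mathfrak{S}_n(bs,x)$ ($n\ge 0$) are defined by the generating function $$\frac{2^{b}x^{bs}\left(\frac{t}{2}\right)^{bs}e^{t(1-x)}}{(bs)!}=\sum_{n=0}^{\infty}\mathfrak{S}_{n}(bs,x)\frac{t^{n}}{n!},\qquad t\in\mathbb{C}$$ (they depend on the pair $(b,s)$, not only on the product $bs$; convention $0^0=1$). For $x\ne 1$ the interpolation function is $$\mathfrak{B}(z,bs;x)=(-1)^{bs}\frac{\Gamma(z+bs)}{\Gamma(bs+1)\Gamma(z)}\,\frac{2^{b(1-s)}x^{bs}}{(1-x)^{z+bs}},$$ defined for $z\in\mathbb{C}$ with $\Re(z)>0$ and extended by the same formula, with $\Gamma$ the meromorphic Euler gamma function, to complex $z$; its values at nonpositive integers $z=-n$ are understood as limits $z\to -n$. *)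

theory Defs
  imports "HOL-Complex_Analysis.Complex_Analysis"
begin

definition S_gen :: "nat \<Rightarrow> nat \<Rightarrow> real \<Rightarrow> complex \<Rightarrow> complex" where
  "S_gen b s x t =
     2 ^ b * of_real x ^ (b * s) * (t / 2) ^ (b * s) * exp (t * (1 - of_real x)) / fact (b * s)"

definition S_seq :: "nat \<Rightarrow> nat \<Rightarrow> real \<Rightarrow> (nat \<Rightarrow> complex) \<Rightarrow> bool" where
  "S_seq b s x a \<longleftrightarrow> (\<forall>t. (\<lambda>n. a n * (t ^ n / fact n)) sums S_gen b s x t)"

lemma S_seq_ex1: "\<exists>!a. S_seq b s x a"
proof (rule ex_ex1I)
  define k where "k = b * s"
  define c where "c = (2 ^ b * of_real x ^ k * (1 / 2) ^ k / fact k :: complex)"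
  define y where "y = (1 - of_real x :: complex)"
  define a where "a n = (if n < k then 0 else c * fact n * y ^ (n - k) / fact (n - k))" for n
  have "(\<lambda>n. a n * (t ^ n / fact n)) sums S_gen b s x t" for t
  proof -
    have "(\<lambda>n. (t * y) ^ n /\<^sub>R fact n) sums exp (t * y)"
      by (rule exp_converges)
    from sums_mult[OF this, of "c * t ^ k"]
    have "(\<lambda>n. a (n + k) * (t ^ (n + k) / fact (n + k))) sums (c * t ^ k * exp (t * y))"
      by (simp add: a_def power_add power_mult_distrib scaleR_conv_of_real divide_simps mult_ac)
    then have "(\<lambda>n. a n * (t ^ n / fact n)) sums (c * t ^ k * exp (t * y))"
      by (subst (asm) sums_zero_iff_shift) (auto simp: a_def)
    also have "c * t ^ k * exp (t * y) = S_gen b s x t"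
      by (simp add: S_gen_def c_def y_def k_def power_divide)
    finally show ?thesis .
  qed
  then show "\<exists>a. S_seq b s x a"
    unfolding S_seq_def by blast
next
  fix a a' :: "nat \<Rightarrow> complex"
  have *: "S_gen b s x has_fps_expansion Abs_fps (\<lambda>n. u n / fact n)" if "S_seq b s x u" for u
    using that by (intro has_fps_expansionI always_eventually) (simp add: S_seq_def)
  assume "S_seq b s x a" "S_seq b s x a'"
  then have "Abs_fps (\<lambda>n. a n / fact n) = Abs_fps (\<lambda>n. a' n / fact n)"
    by (intro fps_expansion_unique_complex[OF * *])
  then show "a = a'"
    by (simp add: fps_eq_iff fun_eq_iff)
qed

definition S_poly :: "nat \<Rightarrow> nat \<Rightarrow> nat \<Rightarrow> real \<Rightarrow> complex" where
  "S_poly n b s x = (THE a. S_seq b s x a) n"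

text \<open>The exponent \<open>b (1 - s)\<close> may be negative, hence the integer power. The base
  \<open>1 - x\<close> is meant to be a positive real, so that its complex power is unambiguous. At the
  poles of the gamma function the library sets \<open>Gamma\<close> to \<open>0\<close>, so the value of
  \<open>B_interp\<close> at nonpositive integers is meaningless; only limits should be taken there.\<close>

definition B_interp :: "nat \<Rightarrow> nat \<Rightarrow> real \<Rightarrow> complex \<Rightarrow> complex" where
  "B_interp b s x z =
     (- 1) ^ (b * s) *
     (Gamma (z + of_nat (b * s)) / (Gamma (of_nat (b * s) + 1) * Gamma z)) *
     (2 powi (int b * (1 - int s)) * of_real x ^ (b * s) /
       of_real (1 - x) powr (z + of_nat (b * s)))"

end

theory Submission
  imports Defs
begin

text \<open>
  Put \<open>k = b s\<close> and \<open>y = 1 - x\<close>. Multiplying the power series of \<open>exp (t y)\<close> by \<open>t\<^sup>k / k!\<close> gives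
  the exponential generating function of \<open>binomial n k * y ^ (n - k)\<close>, so uniqueness of power
  series coefficients yields
  \<open>S\<^sub>n = 2 ^ b * (x / 2) ^ k * binomial n k * y ^ (n - k)\<close> (\<open>S_poly_closed_form\<close>).

  On the other side, \<open>\<Gamma>(z + k) / \<Gamma>(z)\<close> is the rising factorial of \<open>z\<close> wherever \<open>\<Gamma>\<close> has no
  poles; with the sign and the factor \<open>1 / k!\<close> it becomes the generalized binomial coefficient
  of \<open>- z\<close> over \<open>k\<close>, a polynomial in \<open>z\<close> (\<open>B_interp_eq_gbinomial\<close>). So the poles cancel, the
  singularity at \<open>z = - n\<close> is removable, and the limit is obtained by substituting \<open>z = - n\<close>:
  the binomial coefficient becomes \<open>binomial n k\<close> and the power of \<open>y\<close> becomes
  \<open>y ^ (n - k)\<close>, which is the closed form of \<open>S\<^sub>n\<close>.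
\<close>

lemma binomial_egf_sums:
  fixes y t :: complex
  shows "(\<lambda>n. (of_nat (n choose k) * y ^ (n - k)) * (t ^ n / fact n))
           sums (t ^ k / fact k * exp (t * y))"
proof -
  have "(\<lambda>n. (t * y) ^ n /\<^sub>R fact n) sums exp (t * y)"
    by (rule exp_converges)
  from sums_mult[OF this, of "t ^ k / fact k"]
  have "(\<lambda>n. (of_nat (n + k choose k) * y ^ (n + k - k)) * (t ^ (n + k) / fact (n + k)))
          sums (t ^ k / fact k * exp (t * y))"
    by (simp add: binomial_fact power_add power_mult_distrib scaleR_conv_of_real
        divide_simps mult_ac)
  then show ?thesis
    \<comment> \<open>The terms with \<open>n < k\<close> vanish because their binomial coefficients do.\<close>
    by (subst (asm) sums_zero_iff_shift) (auto simp: binomial_eq_0)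
qed

lemma S_poly_closed_form:
  "S_poly n b s x =
     2 ^ b * (of_real x / 2) ^ (b * s) * of_nat (n choose (b * s)) * (1 - of_real x) ^ (n - b * s)"
proof -
  define a :: "nat \<Rightarrow> complex" where
    "a = (\<lambda>n. (2 ^ b * (of_real x / 2) ^ (b * s)) *
              (of_nat (n choose (b * s)) * (1 - of_real x) ^ (n - b * s)))"
  have "S_seq b s x a"
    unfolding S_seq_def
  proof
    fix t :: complex
    from sums_mult[OF binomial_egf_sums[of "b * s" "1 - of_real x" t],
        of "2 ^ b * (of_real x / 2) ^ (b * s)"]
    show "(\<lambda>n. a n * (t ^ n / fact n)) sums S_gen b s x t"
      by (simp add: a_def S_gen_def power_divide mult_ac)
  qed
  then have "(THE a. S_seq b s x a) = a"
    by (rule the1_equality[OF S_seq_ex1])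
  then show ?thesis
    by (simp add: S_poly_def a_def mult_ac)
qed

lemma B_interp_eq_gbinomial:
  assumes "z \<notin> \<int>\<^sub>\<le>\<^sub>0"
  shows "B_interp b s x z =
     ((- z) gchoose (b * s)) *
     (2 powi (int b * (1 - int s)) * of_real x ^ (b * s) /
       of_real (1 - x) powr (z + of_nat (b * s)))"
proof -
  have "Gamma (of_nat (b * s) + 1 :: complex) = fact (b * s)"
    by (metis Gamma_fact add.commute)
  then show ?thesis
    using pochhammer_Gamma[OF assms, of "b * s"]
    by (simp add: B_interp_def gbinomial_pochhammer mult_ac)
qed

text \<open>The poles of \<open>\<Gamma>\<close> are isolated.\<close>

lemma eventually_at_notin_nonpos_Ints:
  "eventually (\<lambda>z :: complex. z \<notin> \<int>\<^sub>\<le>\<^sub>0) (at (- of_nat n))"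
  unfolding eventually_at
proof (intro exI[of _ 1] conjI ballI impI)
  fix z :: complex
  assume z: "z \<noteq> - of_nat n \<and> dist z (- of_nat n) < 1"
  show "z \<notin> \<int>\<^sub>\<le>\<^sub>0"
  proof
    assume "z \<in> \<int>\<^sub>\<le>\<^sub>0"
    then obtain m where m: "z = - of_nat m"
      by (auto elim: nonpos_Ints_cases')
    then have "dist z (- of_nat n) = norm (of_int (int n - int m) :: complex)"
      by (simp add: dist_norm)
    also have "\<dots> = of_int \<bar>int n - int m\<bar>"
      by (simp only: norm_of_int)
    finally have "(of_int \<bar>int n - int m\<bar> :: real) < 1"
      using z by simp
    then have "m = n"
      by linarith
    with z m show False
      by simp
  qed
qed simp

lemma powi_mult_one_minus:
  "(2 :: complex) powi (int b * (1 - int s)) = 2 ^ b / 2 ^ (b * s)"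
proof -
  have "int b * (1 - int s) = int b - int (b * s)"
    by (simp add: algebra_simps)
  then have "(2 :: complex) powi (int b * (1 - int s)) = 2 powi int b / 2 powi int (b * s)"
    by (simp add: power_int_diff del: of_nat_mult)
  then show ?thesis
    by (simp only: power_int_of_nat)
qed

theorem theorem6:
  fixes b n s :: nat and x :: real
  assumes "n \<ge> b * s" and "0 \<le> x" and "x < 1"
  shows "(B_interp b s x \<longlongrightarrow> S_poly n b s x) (at (- of_nat n))"
proof -
  define k where "k = b * s"
  define C :: complex where "C = 2 powi (int b * (1 - int s)) * of_real x ^ k"
  define y :: complex where "y = of_real (1 - x)"
  have y: "y \<noteq> 0" "y \<notin> \<real>\<^sub>\<le>\<^sub>0"
    using assms by (simp_all add: y_def del: of_real_diff)
  have "((\<lambda>z. ((- z) gchoose k) * (C / y powr (z + of_nat k)))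
          \<longlongrightarrow> (- (- of_nat n) gchoose k) * (C / y powr (- of_nat n + of_nat k)))
          (at (- of_nat n))"
    unfolding gbinomial_prod_rev using y by (intro tendsto_intros) auto
  moreover have "eventually (\<lambda>z. ((- z) gchoose k) * (C / y powr (z + of_nat k)) =
      B_interp b s x z) (at (- of_nat n))"
    using eventually_at_notin_nonpos_Ints
    by eventually_elim (simp add: B_interp_eq_gbinomial C_def y_def k_def)
  ultimately have lim: "(B_interp b s x \<longlongrightarrow>
      (- (- of_nat n) gchoose k) * (C / y powr (- of_nat n + of_nat k))) (at (- of_nat n))"
    by (rule Lim_transform_eventually)
  have "- of_nat n + of_nat k = (- of_nat (n - k) :: complex)"
    using assms(1) by (simp add: k_def of_nat_diff)
  then have "C / y powr (- of_nat n + of_nat k) = C * y ^ (n - k)"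
    using y by (simp add: powr_minus powr_nat divide_simps)
  then have "(- (- of_nat n) gchoose k) * (C / y powr (- of_nat n + of_nat k)) = S_poly n b s x"
    by (simp add: S_poly_closed_form binomial_gbinomial C_def y_def k_def
        powi_mult_one_minus power_divide mult_ac)
  with lim show ?thesis
    by simp
qed

end
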